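(* Let $a>0$ be a real number, and let $$P(x)=a_0+a_1\frac{x}{a}+a_2\frac{x(x-1)}{a(a+1)}+\ldots+a_n\frac{x(x-1)\cdots(x-n+1)}{a(a+1)\cdots(a+n-1)}$$ be a real polynomial with $a_j>0$ for all $j=0,1,\ldots,n$. 1. Suppose that $$\frac{a_{k-1}^2}{a_{k-2}a_k}\ge 4\quad\text{for all } 2\le k\le n,\qquad\text{and}\qquad \frac{a_{n-1}}{a_n}\le 1.$$ Then $\mathcal{L}_a(P)$ has only real zeros, all lying in the segment $[-1,0]$. 2. Suppose that $n\ge4$ and that there exists $\alpha$ with $1+\sqrt5\le\alpha<4$ such that $$\frac{a_{k-1}^2}{a_{k-2}a_k}\in\left[\alpha,\frac{8}{\alpha(4-\alpha)}\right]\quad\text{for all } k=2,3,\ldots,n,\qquad\text{and}\qquad\frac{a_{n-1}}{a_n}\le1.$$ Then $\mathcal{L}_a(P)$ has only real zeros, all lying in the segment $[-1,0]$.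
   Context: For real $a>0$, $(a)_0=1$ and $(a)_k=a(a+1)\cdots(a+k-1)$ for $k\ge1$ is the Pochhammer symbol. The linear operator $\mathcal{L}_a:\mathbb{R}[x]\to\mathbb{R}[x]$ is defined by $\mathcal{L}_a\left(\sum_{k=0}^n a_k\frac{x(x-1)\cdots(x-k+1)}{(a)_k}\right)=\sum_{k=0}^n a_kx^k$ (the basis element for $k=0$ being $1$). "Has only real zeros lying in $[-1,0]$" means that every complex zero is real and belongs to $[-1,0]$. Here $n\geq 1$. *)

theory Defs
  imports Complex_Main "HOL-Computational_Algebra.Polynomial"
begin

text \<open>The basis polynomial \<open>x(x-1)\<cdots>(x-k+1) / (a)\<^sub>k\<close>.\<close>

definition newton_basis :: "real \<Rightarrow> nat \<Rightarrow> real poly" where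
  "newton_basis a k = smult (1 / pochhammer a k) (\<Prod>i<k. [:- of_nat i, 1:])"

text \<open>
  For \<open>a > 0\<close> the description below determines the value at every polynomial, independently of
  the chosen expansion (\<open>L_op_newton_sum\<close>, \<open>newton_expansion\<close>), and yields a linear operator.
  No meaning is attached to \<open>L_op a\<close> for \<open>a \<le> 0\<close>.
\<close>

definition L_op :: "real \<Rightarrow> real poly \<Rightarrow> real poly" where
  "L_op a p = (THE q. \<exists>n c. p = (\<Sum>k\<le>n. smult (c k) (newton_basis a k))
                            \<and> q = (\<Sum>k\<le>n. monom (c k) k))"

definition only_real_zeros_in :: "real poly \<Rightarrow> real set \<Rightarrow> bool" where
  "only_real_zeros_in p S \<longleftrightarrow>
     (\<forall>z::complex. poly (map_poly of_real p) z = 0 \<longrightarrow> z \<in> \<real> \<and> Re z \<in> S)"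

lemma falling_prod_degree: "degree (\<Prod>i<k. [:- of_nat i, 1::real:]) = k"
  by (subst degree_prod_sum_eq) (auto simp: one_pCons)

lemma falling_prod_lead: "coeff (\<Prod>i<k. [:- of_nat i, 1::real:]) k = 1"
  using lead_coeff_prod[of "\<lambda>i. [:- of_nat i, 1::real:]" "{..<k}"]
  by (simp add: falling_prod_degree)

lemma newton_basis_degree:
  assumes "a > 0" shows "degree (newton_basis a k) = k"
  using pochhammer_pos[OF assms, of k] by (simp add: newton_basis_def falling_prod_degree)

lemma newton_basis_coeff_top:
  assumes "a > 0" shows "coeff (newton_basis a k) k \<noteq> 0"
  using pochhammer_pos[OF assms, of k] by (simp add: newton_basis_def falling_prod_lead)

lemma newton_independent:
  assumes a: "a > 0"
  shows "(\<Sum>k\<le>n. smult (c k) (newton_basis a k)) = 0 \<Longrightarrow> k \<le> n \<Longrightarrow> c k = 0"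
proof (induction n arbitrary: k)
  case 0
  then show ?case using newton_basis_coeff_top[OF a, of 0] by auto
next
  case (Suc n)
  have "coeff (\<Sum>k\<le>Suc n. smult (c k) (newton_basis a k)) (Suc n)
      = c (Suc n) * coeff (newton_basis a (Suc n)) (Suc n)"
    by (simp add: coeff_sum coeff_eq_0 newton_basis_degree[OF a])
  then have top: "c (Suc n) = 0"
    using newton_basis_coeff_top[OF a, of "Suc n"] unfolding Suc.prems(1) by simp
  then have "(\<Sum>k\<le>n. smult (c k) (newton_basis a k)) = 0"
    using Suc.prems(1) by simp
  from Suc.IH[OF this, of k] show ?case using Suc.prems(2) top by (cases "k = Suc n") auto
qed

lemma pad_sum:
  fixes f :: "real \<Rightarrow> nat \<Rightarrow> real poly"
  assumes "\<And>k. f 0 k = 0" "n \<le> N"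
  shows "(\<Sum>k\<le>n. f (c k) k) = (\<Sum>k\<le>N. f (if k \<le> n then c k else 0) k)"
  by (rule sum.mono_neutral_cong_left) (use assms in auto)

lemma L_op_newton_sum:
  assumes a: "a > 0"
  shows "L_op a (\<Sum>k\<le>n. smult (c k) (newton_basis a k)) = (\<Sum>k\<le>n. monom (c k) k)"
  unfolding L_op_def
proof (rule the_equality)
  show "\<exists>m d. (\<Sum>k\<le>n. smult (c k) (newton_basis a k)) = (\<Sum>k\<le>m. smult (d k) (newton_basis a k))
           \<and> (\<Sum>k\<le>n. monom (c k) k) = (\<Sum>k\<le>m. monom (d k) k)" by blast
next
  fix q
  assume "\<exists>m d. (\<Sum>k\<le>n. smult (c k) (newton_basis a k)) = (\<Sum>k\<le>m. smult (d k) (newton_basis a k))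
           \<and> q = (\<Sum>k\<le>m. monom (d k) k)"
  then obtain m d where
    e: "(\<Sum>k\<le>n. smult (c k) (newton_basis a k)) = (\<Sum>k\<le>m. smult (d k) (newton_basis a k))"
    and q: "q = (\<Sum>k\<le>m. monom (d k) k)" by blast
  define N where "N = max m n"
  define c' where "c' k = (if k \<le> n then c k else 0)" for k
  define d' where "d' k = (if k \<le> m then d k else 0)" for k
  have "(\<Sum>k\<le>N. smult (c' k) (newton_basis a k)) = (\<Sum>k\<le>N. smult (d' k) (newton_basis a k))"
    using e pad_sum[of "\<lambda>x k. smult x (newton_basis a k)" n N c]
      pad_sum[of "\<lambda>x k. smult x (newton_basis a k)" m N d]
    unfolding c'_def d'_def N_def by simp
  then have "(\<Sum>k\<le>N. smult (c' k - d' k) (newton_basis a k)) = 0"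
    by (simp add: smult_diff_left sum_subtractf)
  then have "c' k = d' k" if "k \<le> N" for k
    using newton_independent[OF a, of "\<lambda>k. c' k - d' k" N k] that by simp
  then have "(\<Sum>k\<le>N. monom (c' k) k) = (\<Sum>k\<le>N. monom (d' k) k)" by simp
  then show "q = (\<Sum>k\<le>n. monom (c k) k)"
    using q pad_sum[of monom n N c] pad_sum[of monom m N d]
    unfolding c'_def d'_def N_def by simp
qed

lemma newton_expansion:
  assumes a: "a > 0"
  shows "degree p \<le> n \<Longrightarrow> \<exists>c. p = (\<Sum>k\<le>n. smult (c k) (newton_basis a k))"
proof (induction n arbitrary: p)
  case 0
  then obtain r where "p = [:r:]" using degree_eq_zeroE by blast
  then show ?case by (intro exI[of _ "\<lambda>_. r"]) (simp add: newton_basis_def)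
next
  case (Suc n)
  define s where "s = coeff p (Suc n) / coeff (newton_basis a (Suc n)) (Suc n)"
  define r where "r = p - smult s (newton_basis a (Suc n))"
  have "coeff r i = 0" if "i > n" for i
  proof (cases "i = Suc n")
    case True
    then show ?thesis using newton_basis_coeff_top[OF a, of "Suc n"] by (simp add: r_def s_def)
  next
    case False
    then have "i > Suc n" using that by simp
    then show ?thesis using Suc.prems
      by (simp add: r_def coeff_eq_0 newton_basis_degree[OF a])
  qed
  then have "degree r \<le> n" by (intro degree_le) auto
  from Suc.IH[OF this] obtain c where c: "r = (\<Sum>k\<le>n. smult (c k) (newton_basis a k))" by blast
  have "p = r + smult s (newton_basis a (Suc n))" by (simp add: r_def)
  also have "\<dots> = (\<Sum>k\<le>Suc n. smult ((c(Suc n := s)) k) (newton_basis a k))"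
    by (simp add: c)
  finally show ?case by blast
qed

lemma L_op_add:
  assumes a: "a > 0" shows "L_op a (p + q) = L_op a p + L_op a q"
proof -
  define N where "N = max (degree p) (degree q)"
  obtain c where c: "p = (\<Sum>k\<le>N. smult (c k) (newton_basis a k))"
    using newton_expansion[OF a, of p N] by (auto simp: N_def)
  obtain d where d: "q = (\<Sum>k\<le>N. smult (d k) (newton_basis a k))"
    using newton_expansion[OF a, of q N] by (auto simp: N_def)
  have "p + q = (\<Sum>k\<le>N. smult (c k + d k) (newton_basis a k))"
    by (simp add: c d smult_add_left sum.distrib)
  then show ?thesis
    by (simp add: c d L_op_newton_sum[OF a] sum.distrib add_monom[symmetric])
qed

lemma smult_sum_right: "smult r (\<Sum>i\<in>A. f i) = (\<Sum>i\<in>A. smult r (f i))"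
  by (induction A rule: infinite_finite_induct) (simp_all add: smult_add_right)

lemma L_op_smult:
  assumes a: "a > 0" shows "L_op a (smult r p) = smult r (L_op a p)"
proof -
  obtain c where c: "p = (\<Sum>k\<le>degree p. smult (c k) (newton_basis a k))"
    using newton_expansion[OF a, of p "degree p"] by auto
  define N where "N = degree p"
  have c: "p = (\<Sum>k\<le>N. smult (c k) (newton_basis a k))" using c by (simp add: N_def)
  have "smult r p = (\<Sum>k\<le>N. smult (r * c k) (newton_basis a k))"
    by (simp add: c smult_sum_right)
  then show ?thesis
    by (simp add: c L_op_newton_sum[OF a] smult_sum_right smult_monom)
qed

end

theory Submission
  imports Defs
begin

text \<open>
  The operator turns \<open>P\<close> into \<open>Q = \<Sum> c\<^sub>k x\<^sup>k\<close>, so the assertion concerns a polynomial with positive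
  coefficients whose quotients \<open>q\<^sub>k = c\<^sub>k\<^sub>-\<^sub>1\<^sup>2 / (c\<^sub>k\<^sub>-\<^sub>2 c\<^sub>k)\<close> are large. For such coefficients the terms
  \<open>c\<^sub>j y\<^sup>j\<close> rise up to one peak and fall afterwards. If the peak is at \<open>k\<close>, the sign of \<open>Q(-y)\<close> should
  be that of its \<open>k\<close>-th term, namely \<open>(-1)\<^sup>k\<close>, provided the peak outweighs its neighbours.
  The peak is at \<open>k\<close> exactly for \<open>y\<close> between \<open>c\<^sub>k\<^sub>-\<^sub>1 / c\<^sub>k\<close> and \<open>c\<^sub>k / c\<^sub>k\<^sub>+\<^sub>1\<close>, and these intervals are ordered
  from left to right. One point with the right sign in every interval, together with \<open>0\<close> and a
  point far to the right, thus gives \<open>n\<close> sign changes of \<open>y \<mapsto> Q(-y)\<close>, and all zeros of \<open>Q\<close> are real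
  (\<open>sign_points_imp_real_zeros\<close>).
  At the boundary of the admissible quotients \<open>Q\<close> can have double zeros, so only weak inequalities
  for the signs are available; \<open>weak_alternation_imp_real_zeros\<close> shows that they suffice.

  A real zero \<open>-y\<close> with \<open>y > 1\<close> is impossible: since \<open>c\<^sub>n\<^sub>-\<^sub>1 \<le> c\<^sub>n\<close>, the terms \<open>c\<^sub>j y\<^sup>j\<close> then rise up to
  \<open>j = n\<close> and the last one determines the sign. Positive zeros are excluded by the positive
  coefficients.

  The points are found as follows. If \<open>q\<^sub>k\<^sub>+\<^sub>1 \<ge> 4\<close>, choose \<open>y\<close> so that the two neighbours of the peak
  are equal; then each is at most half of the peak (\<open>sign_point_of_ratio_ge_4\<close>).
  In the second part the same choice works for \<open>2 \<le> k \<le> n - 2\<close>, because the upper bound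
  \<open>8 / (\<alpha> (4 - \<alpha>))\<close> makes the terms with indices \<open>k - 2\<close> and \<open>k + 2\<close> large enough to compensate
  (\<open>sign_point_middle\<close>). For \<open>k = 1\<close> there is help from one side only. Here the sum of the first
  five terms is compared with the symmetric quartic with quotients \<open>\<alpha>, b, \<alpha>\<close>, where \<open>b = q\<^sub>3\<close>.
  It becomes a quadratic in \<open>Z = 1/Y + Y/b\<close>, and the upper bound on \<open>b\<close> says precisely that its
  discriminant is nonnegative (\<open>quartic_point_exists\<close>). The case \<open>k = n - 1\<close> follows by reversing the
  order of the coefficients (\<open>sign_point_reverse\<close>).
\<close>

section \<open>Polynomials with alternating signs have only real zeros\<close>

lemma poly_map_poly_complex_of_real:
  "poly (map_poly complex_of_real p) (of_real x) = of_real (poly p x)"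
  by (induction p) (simp_all add: map_poly_pCons)

lemma decreasing_steps_antimono:
  fixes x :: "nat \<Rightarrow> real"
  assumes dec: "\<And>k. k < n \<Longrightarrow> x (Suc k) < x k" and "k \<le> l" "l \<le> n"
  shows "x l \<le> x k"
  using assms(2,3)
proof (induction rule: dec_induct)
  case (step l)
  then show ?case using dec[of l] by fastforce
qed simp

text \<open>
  The \<open>n\<close> sign changes give the complete factorization of \<open>p\<close> into real linear factors, and
  \<open>cmod (z - r) \<ge> \<bar>Im z\<bar>\<close> for every real \<open>r\<close>. The conclusion is a quantitative form of having only
  real zeros, chosen because it is preserved under limits of polynomials.
\<close>

lemma strict_alternation_norm_bound:
  fixes p :: "real poly" and x :: "nat \<Rightarrow> real"
  assumes deg: "degree p \<le> n" and lead: "coeff p n \<ge> 0"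
    and dec: "\<And>k. k < n \<Longrightarrow> x (Suc k) < x k"
    and alt: "\<And>k. k \<le> n \<Longrightarrow> (-1) ^ k * poly p (x k) > 0"
  shows "coeff p n * \<bar>Im z\<bar> ^ n \<le> cmod (poly (map_poly of_real p) z)"
proof -
  let ?P = "map_poly complex_of_real p"
  have "\<exists>r. x (Suc k) < r \<and> r < x k \<and> poly p r = 0" if k: "k < n" for k
  proof -
    have "((-1) ^ k * poly p (x k)) * ((-1) ^ Suc k * poly p (x (Suc k))) > 0"
      by (rule mult_pos_pos[OF alt alt]) (use k in auto)
    also have "((-1) ^ k * poly p (x k)) * ((-1) ^ Suc k * poly p (x (Suc k)))
             = - (((-1) ^ k * (-1) ^ k) * (poly p (x (Suc k)) * poly p (x k)))"
      by (simp add: mult_ac)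
    also have "(-1::real) ^ k * (-1) ^ k = 1"
      by (simp flip: power_mult_distrib)
    finally have "poly p (x (Suc k)) * poly p (x k) < 0" by simp
    from poly_IVT[OF dec[OF k] this] show ?thesis by blast
  qed
  then obtain r where r: "\<And>k. k < n \<Longrightarrow> x (Suc k) < r k \<and> r k < x k \<and> poly p (r k) = 0"
    by metis
  note anti = decreasing_steps_antimono[of n x, OF dec]
  have less: "r l < r k" if "k < l" "l < n" for k l
    using r[of l] r[of k] anti[of "Suc k" l] that by fastforce
  have inj: "inj_on r {..<n}"
    by (rule linorder_inj_onI) (use less in force)+
  let ?R = "smult (of_real (coeff p n)) (\<Prod>k<n. [:- complex_of_real (r k), 1:])"
  have degR: "degree (\<Prod>k<n. [:- complex_of_real (r k), 1:]) = n"
    by (subst degree_prod_sum_eq) auto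
  have leadR: "coeff (\<Prod>k<n. [:- complex_of_real (r k), 1:]) n = 1"
    using lead_coeff_prod[of "\<lambda>k. [:- complex_of_real (r k), 1:]" "{..<n}"]
    by (simp only: degR) simp
  have "?P = ?R"
  proof (rule poly_eqI_degree_lead_coeff[where n = n and A = "(\<lambda>k. complex_of_real (r k)) ` {..<n}"])
    show "coeff ?P n = coeff ?R n" by (simp add: coeff_map_poly leadR)
    have "inj_on (\<lambda>k. complex_of_real (r k)) {..<n}"
      using inj by (auto simp: inj_on_def)
    then show "n \<le> card ((\<lambda>k. complex_of_real (r k)) ` {..<n})" by (simp add: card_image)
    show "degree ?P \<le> n" using deg by (simp add: degree_map_poly)
    show "degree ?R \<le> n" using degR degree_smult_le[of "complex_of_real (coeff p n)"] by metis
    fix z assume "z \<in> (\<lambda>k. complex_of_real (r k)) ` {..<n}"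
    then obtain k where k: "k < n" "z = of_real (r k)" by auto
    then have "poly ?P z = 0" using r[of k] by (simp add: poly_map_poly_complex_of_real)
    moreover have "poly ?R z = 0" using k by (auto simp: poly_prod)
    ultimately show "poly ?P z = poly ?R z" by simp
  qed
  then have "cmod (poly ?P z) = coeff p n * (\<Prod>k<n. cmod (z - of_real (r k)))"
    using lead by (simp add: poly_prod norm_mult prod_norm)
  moreover have "(\<Prod>k<n. \<bar>Im z\<bar>) \<le> (\<Prod>k<n. cmod (z - of_real (r k)))"
  proof (rule prod_mono)
    fix k
    show "0 \<le> \<bar>Im z\<bar> \<and> \<bar>Im z\<bar> \<le> cmod (z - of_real (r k))"
      using abs_Im_le_cmod[of "z - of_real (r k)"] by simp
  qed
  ultimately show ?thesis using lead by (simp add: mult_left_mono)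
qed

text \<open>
  The product of the linear factors vanishing at the midpoints of consecutive points changes its
  sign exactly once between any two of them.
\<close>

lemma exists_strictly_alternating_poly:
  fixes x :: "nat \<Rightarrow> real"
  assumes dec: "\<And>k. k < n \<Longrightarrow> x (Suc k) < x k"
  shows "\<exists>R. degree R = n \<and> coeff R n = 1 \<and> (\<forall>k\<le>n. (-1) ^ k * poly R (x k) > 0)"
proof -
  define m where "m k = (x k + x (Suc k)) / 2" for k
  define R where "R = (\<Prod>k<n. [:- m k, 1:])"
  note anti = decreasing_steps_antimono[of n x, OF dec]
  have deg: "degree R = n"
    unfolding R_def by (subst degree_prod_sum_eq) auto
  moreover have "coeff R n = 1"
    using lead_coeff_prod[of "\<lambda>k. [:- m k, 1:]" "{..<n}"] deg unfolding R_def by simp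
  moreover have "(-1) ^ k * poly R (x k) > 0" if k: "k \<le> n" for k
  proof -
    have "poly R (x k) = (\<Prod>j<n. x k - m j)" by (simp add: R_def poly_prod)
    also have "\<dots> = (\<Prod>j<k. x k - m j) * (\<Prod>j\<in>{k..<n}. x k - m j)"
      using prod.union_disjoint[of "{..<k}" "{k..<n}" "\<lambda>j. x k - m j"] k
      by (simp add: ivl_disj_un ivl_disj_int)
    also have "(\<Prod>j<k. x k - m j) = (-1) ^ k * (\<Prod>j<k. m j - x k)"
      using prod.distrib[of "\<lambda>_. -1" "\<lambda>j. m j - x k" "{..<k}"] by simp
    finally have "(-1) ^ k * poly R (x k)
        = ((-1) ^ k * (-1) ^ k) * ((\<Prod>j<k. m j - x k) * (\<Prod>j\<in>{k..<n}. x k - m j))"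
      by (simp add: mult_ac)
    also have "(-1::real) ^ k * (-1) ^ k = 1" by (simp flip: power_mult_distrib)
    finally have eq: "(-1) ^ k * poly R (x k)
        = (\<Prod>j<k. m j - x k) * (\<Prod>j\<in>{k..<n}. x k - m j)" by simp
    have "m j - x k > 0" if "j < k" for j
      using dec[of j] anti[of "Suc j" k] that k by (auto simp: m_def)
    moreover have "x k - m j > 0" if "k \<le> j" "j < n" for j
      using dec[of j] anti[of k j] that k by (auto simp: m_def)
    ultimately show ?thesis unfolding eq by (intro mult_pos_pos prod_pos) auto
  qed
  ultimately show ?thesis by blast
qed

text \<open>
  Adding a small positive multiple of a strictly alternating polynomial makes the alternation of
  \<open>p\<close> strict, and the norm bound for the perturbed polynomials survives as the multiple tends to
  zero. Multiple zeros of \<open>p\<close> need no separate treatment in this way.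
\<close>

lemma weak_alternation_imp_real_zeros:
  fixes p :: "real poly" and x :: "nat \<Rightarrow> real"
  assumes deg: "degree p \<le> n" and lead: "coeff p n > 0"
    and dec: "\<And>k. k < n \<Longrightarrow> x (Suc k) < x k"
    and alt: "\<And>k. k \<le> n \<Longrightarrow> (-1) ^ k * poly p (x k) \<ge> 0"
    and zero: "poly (map_poly of_real p) (z::complex) = 0"
  shows "z \<in> \<real>"
proof (rule ccontr)
  assume "z \<notin> \<real>"
  then have Im: "\<bar>Im z\<bar> > 0" by (simp add: complex_is_Real_iff)
  obtain R where R: "degree R = n" "coeff R n = 1" "\<And>k. k \<le> n \<Longrightarrow> (-1) ^ k * poly R (x k) > 0"
    using exists_strictly_alternating_poly[of n x] dec by blast
  define M where "M = cmod (poly (map_poly of_real R) z)"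
  \<comment> \<open>at the zero \<open>z\<close> only the perturbing term contributes\<close>
  have bound: "coeff p n * \<bar>Im z\<bar> ^ n \<le> e * M" if e: "e > 0" for e
  proof -
    have "map_poly complex_of_real (p + smult e R)
        = map_poly of_real p + smult (of_real e) (map_poly of_real R)"
      by (rule poly_eqI) (simp add: coeff_map_poly)
    then have val: "poly (map_poly complex_of_real (p + smult e R)) z
        = of_real e * poly (map_poly of_real R) z"
      using zero by simp
    have "(coeff p n + e) * \<bar>Im z\<bar> ^ n \<le> e * M"
      using strict_alternation_norm_bound[of "p + smult e R" n x z] deg lead dec e R alt
      by (simp add: val M_def norm_mult degree_add_le degree_smult_le distrib_left
          mult.left_commute add_nonneg_pos)
    then show ?thesis using e by (simp add: distrib_right) (smt (verit) zero_le_power mult_nonneg_nonneg Im)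
  qed
  have pos: "coeff p n * \<bar>Im z\<bar> ^ n > 0" using lead Im by simp
  have "M \<ge> 0" by (simp add: M_def)
  \<comment> \<open>makes the right-hand side of the bound at most half of its left-hand side\<close>
  define e where "e = coeff p n * \<bar>Im z\<bar> ^ n / (2 * (M + 1))"
  have "e > 0" using pos \<open>M \<ge> 0\<close> by (simp add: e_def)
  have "e * M \<le> e * (M + 1)" using \<open>e > 0\<close> by simp
  also have "e * (M + 1) = coeff p n * \<bar>Im z\<bar> ^ n / 2"
    using \<open>M \<ge> 0\<close> by (simp add: e_def field_simps)
  finally show False using bound[OF \<open>e > 0\<close>] pos by simp
qed

section \<open>Log-concave sequences\<close>

text \<open>
  The condition that all quotients \<open>t\<^sub>j\<^sub>+\<^sub>1\<^sup>2 / (t\<^sub>j t\<^sub>j\<^sub>+\<^sub>2)\<close> are at least \<open>\<alpha>\<close>, written without division;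
  ordinary log-concavity is the case \<open>\<alpha> = 1\<close>.
\<close>

definition log_concave_upto :: "real \<Rightarrow> nat \<Rightarrow> (nat \<Rightarrow> real) \<Rightarrow> bool" where
  "log_concave_upto \<alpha> n t \<longleftrightarrow>
     (\<forall>j\<le>n. t j > 0) \<and> (\<forall>j. j + 2 \<le> n \<longrightarrow> \<alpha> * (t j * t (j + 2)) \<le> (t (j + 1))\<^sup>2)"

lemma log_concave_upto_pos: "log_concave_upto \<alpha> n t \<Longrightarrow> j \<le> n \<Longrightarrow> t j > 0"
  by (simp add: log_concave_upto_def)

lemma log_concave_upto_ineq:
  "log_concave_upto \<alpha> n t \<Longrightarrow> j + 2 \<le> n \<Longrightarrow> \<alpha> * (t j * t (j + 2)) \<le> (t (j + 1))\<^sup>2"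
  by (simp add: log_concave_upto_def)

lemma log_concave_upto_of_ratio_ge:
  assumes pos: "\<forall>j\<le>n. c j > 0"
    and ratio: "\<forall>k\<in>{2..n}. \<alpha> \<le> (c (k - 1))\<^sup>2 / (c (k - 2) * c k)"
  shows "log_concave_upto \<alpha> n c"
  unfolding log_concave_upto_def
proof (intro conjI allI impI)
  fix j assume j: "j + 2 \<le> n"
  then have "\<alpha> \<le> (c (j + 1))\<^sup>2 / (c j * c (j + 2))"
    using ratio[rule_format, of "j + 2"] by simp
  moreover have "c j * c (j + 2) > 0" using pos j by simp
  ultimately show "\<alpha> * (c j * c (j + 2)) \<le> (c (j + 1))\<^sup>2" by (simp only: pos_le_divide_eq)
qed (use pos in blast)

lemma log_concave_upto_weaken:
  assumes t: "log_concave_upto \<alpha> n t" and "\<beta> \<le> \<alpha>"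
  shows "log_concave_upto \<beta> n t"
  unfolding log_concave_upto_def
proof (intro conjI allI impI)
  fix j assume j: "j + 2 \<le> n"
  then have "0 \<le> t j * t (j + 2)"
    using log_concave_upto_pos[OF t, of j] log_concave_upto_pos[OF t, of "j + 2"] by simp
  then have "\<beta> * (t j * t (j + 2)) \<le> \<alpha> * (t j * t (j + 2))"
    using \<open>\<beta> \<le> \<alpha>\<close> by (rule mult_right_mono[rotated])
  also have "\<dots> \<le> (t (j + 1))\<^sup>2" by (rule log_concave_upto_ineq[OF t j])
  finally show "\<beta> * (t j * t (j + 2)) \<le> (t (j + 1))\<^sup>2" .
qed (rule log_concave_upto_pos[OF t])

lemma log_concave_upto_reverse:
  assumes t: "log_concave_upto \<alpha> n t"
  shows "log_concave_upto \<alpha> n (\<lambda>j. t (n - j))"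
  unfolding log_concave_upto_def
proof (intro conjI allI impI)
  fix j assume "j + 2 \<le> n"
  then obtain i where n: "n = i + j + 2" by (metis add.commute add.left_commute le_iff_add)
  then have "n - j = i + 2" "n - (j + 2) = i" "n - (j + 1) = i + 1" by auto
  then show "\<alpha> * (t (n - j) * t (n - (j + 2))) \<le> (t (n - (j + 1)))\<^sup>2"
    using log_concave_upto_ineq[OF t, of i] n by (simp add: mult.commute)
qed (use log_concave_upto_pos[OF t] in simp)

text \<open>
  Both sides of a log-concavity inequality acquire the same factor when the sequence is weighted by
  powers of \<open>y\<close>, so the quotients of the terms of a polynomial are those of its coefficients.
\<close>

lemma power_weight_products:
  fixes c :: "nat \<Rightarrow> real"
  shows "(c j * y ^ j) * (c (j + 2) * y ^ (j + 2)) = (c j * c (j + 2)) * (y ^ (j + 1))\<^sup>2"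
    and "(c (j + 1) * y ^ (j + 1))\<^sup>2 = (c (j + 1))\<^sup>2 * (y ^ (j + 1))\<^sup>2"
  by (simp_all add: power2_eq_square mult_ac)

lemma power_weight_product_centred:
  fixes c :: "nat \<Rightarrow> real"
  assumes "0 < k"
  shows "(c (k - 1) * y ^ (k - 1)) * (c (k + 1) * y ^ (k + 1)) = (c (k - 1) * c (k + 1)) * (y ^ k)\<^sup>2"
  using power_weight_products(1)[of c "k - 1" y] assms by simp

lemma log_concave_upto_scale:
  assumes c: "log_concave_upto \<alpha> n c" and y: "y > 0"
  shows "log_concave_upto \<alpha> n (\<lambda>j. c j * y ^ j)"
  unfolding log_concave_upto_def
proof (intro conjI allI impI)
  fix j assume "j + 2 \<le> n"
  then have "\<alpha> * (c j * c (j + 2)) * (y ^ (j + 1))\<^sup>2 \<le> (c (j + 1))\<^sup>2 * (y ^ (j + 1))\<^sup>2"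
    using log_concave_upto_ineq[OF c] by (intro mult_right_mono) auto
  then show "\<alpha> * ((c j * y ^ j) * (c (j + 2) * y ^ (j + 2))) \<le> (c (j + 1) * y ^ (j + 1))\<^sup>2"
    unfolding power_weight_products by (simp only: mult.assoc)
qed (use log_concave_upto_pos[OF c] y in simp)

lemma log_concave_upto_ineq_centred:
  assumes "log_concave_upto \<alpha> n t" "0 < k" "k < n"
  shows "\<alpha> * (t (k - 1) * t (k + 1)) \<le> (t k)\<^sup>2"
  using log_concave_upto_ineq[OF assms(1), of "k - 1"] assms(2,3) by simp

lemma log_concave_upto_strict:
  assumes t: "log_concave_upto \<alpha> n t" "\<alpha> > 1" and k: "0 < k" "k < n"
  shows "t (k - 1) * t (k + 1) < (t k)\<^sup>2"
proof -
  have "0 < t (k - 1) * t (k + 1)" using log_concave_upto_pos[OF t(1)] k by simp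
  then have "1 * (t (k - 1) * t (k + 1)) < \<alpha> * (t (k - 1) * t (k + 1))"
    using t(2) by (intro mult_strict_right_mono)
  also have "\<dots> \<le> (t k)\<^sup>2" by (rule log_concave_upto_ineq_centred[OF t(1) k])
  finally show ?thesis by simp
qed

lemma log_concave_decreasing_tail:
  assumes t: "log_concave_upto 1 n t" and i: "t (Suc i) \<le> t i" "i \<le> j" "Suc j \<le> n"
  shows "t (Suc j) \<le> t j"
  using i(2,3)
proof (induction rule: dec_induct)
  case base
  show ?case by (rule i(1))
next
  case (step j)
  have pos: "t j > 0" "t (Suc j) > 0" "t (Suc (Suc j)) > 0"
    using t step.prems by (auto simp: log_concave_upto_def)
  have "t j * t (Suc (Suc j)) \<le> (t (Suc j))\<^sup>2"
    using log_concave_upto_ineq[OF t, of j] step.prems by simp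
  also have "\<dots> \<le> t j * t (Suc j)"
    using step.IH step.prems pos by (simp add: power2_eq_square)
  finally show ?case using pos by simp
qed

section \<open>Alternating sums split at a peak\<close>

lemma alternating_sum_Suc:
  fixes s :: "nat \<Rightarrow> real"
  shows "(\<Sum>j<Suc m. (-1) ^ j * s j) = s 0 - (\<Sum>j<m. (-1) ^ j * s (Suc j))"
  by (simp add: sum.lessThan_Suc_shift sum_negf del: sum.lessThan_Suc)

text \<open>
  The lower bound at one length and the upper bound at the next one imply each other, because
  removing the first term turns an alternating sum into the negative of a shorter one. Therefore
  both are proved in a single induction.
\<close>

lemma alternating_sum_bounds:
  fixes s :: "nat \<Rightarrow> real"
  assumes "\<And>j. j < m \<Longrightarrow> 0 \<le> s j"
    and "\<And>j. Suc j < m \<Longrightarrow> s (Suc j) \<le> s j"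
  shows "0 \<le> (\<Sum>j<m. (-1) ^ j * s j) \<and> (m > 0 \<longrightarrow> (\<Sum>j<m. (-1) ^ j * s j) \<le> s 0)"
  using assms
proof (induction m arbitrary: s)
  case (Suc m)
  have IH: "0 \<le> (\<Sum>j<m. (-1) ^ j * s (Suc j))"
           "m > 0 \<longrightarrow> (\<Sum>j<m. (-1) ^ j * s (Suc j)) \<le> s 1"
    using Suc.IH[of "\<lambda>j. s (Suc j)"] Suc.prems by auto
  have "(\<Sum>j<m. (-1) ^ j * s (Suc j)) \<le> s 0"
  proof (cases "m = 0")
    case False
    then show ?thesis using IH(2) Suc.prems(2)[of 0] by auto
  qed (use Suc.prems(1)[of 0] in simp)
  then show ?case using IH unfolding alternating_sum_Suc by simp
qed simp

text \<open>
  The part of an alternating sum to the right of \<open>k\<close>, with sign such that its first term is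
  positive. The part to the left of \<open>k\<close> is the right tail of the reversed sequence, so all
  bounds are needed for right tails only.
\<close>

definition right_tail :: "nat \<Rightarrow> (nat \<Rightarrow> real) \<Rightarrow> nat \<Rightarrow> real" where
  "right_tail n t k = (\<Sum>j<n - k. (-1) ^ j * t (k + 1 + j))"

lemma right_tail_step:
  assumes "k < n"
  shows "right_tail n t k = t (k + 1) - right_tail n t (k + 1)"
proof -
  have "n - k = Suc (n - (k + 1))" using assms by simp
  then show ?thesis
    unfolding right_tail_def by (simp only: alternating_sum_Suc) simp
qed

text \<open>
  Once a log-concave sequence has stopped increasing, at the index \<open>i\<close>, it decreases from there on,
  so the peak may lie at \<open>k\<close> or anywhere to its left.
\<close>

lemma right_tail_bounds:
  assumes t: "log_concave_upto 1 n t" and i: "i \<le> k" "i < n" "t (i + 1) \<le> t i"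
  shows "0 \<le> right_tail n t k" and "k < n \<Longrightarrow> right_tail n t k \<le> t (k + 1)"
  using alternating_sum_bounds[of "n - k" "\<lambda>j. t (k + 1 + j)"]
    log_concave_decreasing_tail[OF t, of i] log_concave_upto_pos[OF t] i
  unfolding right_tail_def by (force intro: less_imp_le)+

lemma alternating_sum_split:
  fixes t :: "nat \<Rightarrow> real"
  assumes "k \<le> n"
  shows "(\<Sum>j\<le>n. (-1) ^ (j + k) * t j)
       = t k - right_tail n (\<lambda>j. t (n - j)) (n - k) - right_tail n t k"
proof -
  let ?f = "\<lambda>j. (-1) ^ (j + k) * t j"
  have "{..n} = {..<k} \<union> {k} \<union> {k<..n}" using assms by auto
  then have "sum ?f {..n} = sum ?f ({..<k} \<union> {k}) + sum ?f {k<..n}"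
    by (simp only:) (rule sum.union_disjoint, auto)
  also have "sum ?f ({..<k} \<union> {k}) = sum ?f {..<k} + t k"
    by (subst sum.union_disjoint) (auto simp flip: mult_2)
  also have "sum ?f {..<k} = - right_tail n (\<lambda>j. t (n - j)) (n - k)"
  proof -
    have "sum ?f {..<k} = (\<Sum>j<k. ?f (k - Suc j))"
      by (rule sum.nat_diff_reindex[symmetric])
    also have "\<dots> = (\<Sum>j<k. - ((-1) ^ j * t (n - (n - k + 1 + j))))"
    proof (rule sum.cong)
      fix j assume "j \<in> {..<k}"
      then obtain i where k: "k = Suc j + i" by (metis lessThan_iff less_iff_Suc_add add_Suc)
      have "n - (n - k + 1 + j) = k - Suc j" using assms k by simp
      moreover have "(-1::real) ^ (k - Suc j + k) = - ((-1) ^ j)"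
      proof -
        have "k - Suc j + k = Suc (j + 2 * i)" using k by simp
        then show ?thesis by (simp only: power_Suc power_add power_mult) simp
      qed
      ultimately show "?f (k - Suc j) = - ((-1) ^ j * t (n - (n - k + 1 + j)))" by simp
    qed simp
    finally show ?thesis using assms by (simp add: right_tail_def sum_negf)
  qed
  also have "sum ?f {k<..n} = (\<Sum>j<n - k. ?f (k + 1 + j))"
    by (rule sum.reindex_bij_witness[of _ "\<lambda>j. k + 1 + j" "\<lambda>j. j - (k + 1)"]) auto
  also have "\<dots> = - right_tail n t k"
  proof -
    have "?f (k + 1 + j) = - ((-1) ^ j * t (k + 1 + j))" for j
    proof -
      have "k + 1 + j + k = Suc (j + 2 * k)" by simp
      then show ?thesis by (simp only: power_Suc power_add power_mult) simp
    qed
    then show ?thesis by (simp only: right_tail_def sum_negf)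
  qed
  finally show ?thesis by simp
qed

lemma alternating_sum_ge_neighbours:
  assumes t: "log_concave_upto 1 n t" and k: "0 < k" "k < n"
    and le: "t (k - 1) \<le> t k" "t (k + 1) \<le> t k"
  shows "t k - t (k - 1) - t (k + 1) \<le> (\<Sum>j\<le>n. (-1) ^ (j + k) * t j)"
proof -
  have "right_tail n t k \<le> t (k + 1)"
    using right_tail_bounds(2)[OF t, of k k] k le by simp
  moreover have "n - (n - k + 1) = k - 1" "n - (n - k) = k" using k by auto
  then have "right_tail n (\<lambda>j. t (n - j)) (n - k) \<le> t (k - 1)"
    using right_tail_bounds(2)[OF log_concave_upto_reverse[OF t], of "n - k" "n - k"] k le by simp
  ultimately show ?thesis using alternating_sum_split[of k n t] k by simp
qed

lemma alternating_sum_top_pos: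
  assumes t: "log_concave_upto 1 n t" and n: "n \<ge> 1" and less: "t (n - 1) < t n"
  shows "0 < (\<Sum>j\<le>n. (-1) ^ (j + n) * t j)"
proof -
  have "right_tail n (\<lambda>j. t (n - j)) 0 \<le> t (n - 1)"
    using right_tail_bounds(2)[OF log_concave_upto_reverse[OF t], of 0 0] n less by simp
  moreover have "right_tail n t n = 0" by (simp add: right_tail_def)
  ultimately show ?thesis using alternating_sum_split[of n n t] less by simp
qed

text \<open>
  To the right of a peak the terms at least halve at every step from \<open>k + 1\<close> on, and the step from
  \<open>k + 2\<close> to \<open>k + 3\<close> gains a factor of four; hence the third term cancels at most a quarter of the
  second one.
\<close>

lemma right_tail_le_two_terms:
  assumes t: "log_concave_upto \<alpha> n t" and \<alpha>: "\<alpha> \<ge> 2"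
    and k: "k + 2 \<le> n" and le: "t (k + 1) \<le> t k"
  shows "right_tail n t k \<le> t (k + 1) - 3 / 4 * t (k + 2)"
proof -
  have t1: "log_concave_upto 1 n t" using log_concave_upto_weaken[OF t] \<alpha> by simp
  have pos: "t k > 0" "t (k + 1) > 0" "t (k + 2) > 0"
    using log_concave_upto_pos[OF t] k by auto
  have "t k * (2 * t (k + 2)) \<le> (t (k + 1))\<^sup>2"
    using log_concave_upto_ineq[OF log_concave_upto_weaken[OF t \<alpha>], of k] k by (simp add: mult_ac)
  also have "\<dots> \<le> t k * t (k + 1)" using le pos by (simp add: power2_eq_square)
  finally have h: "2 * t (k + 2) \<le> t (k + 1)" using pos by simp
  have "right_tail n t (k + 2) \<le> t (k + 2) / 4"
  proof (cases "k + 3 \<le> n")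
    case False
    then show ?thesis using pos k by (simp add: right_tail_def)
  next
    case True
    have le2: "t (k + 2) \<le> t (k + 1)" using h pos by simp
    have p3: "t (k + 3) > 0" using log_concave_upto_pos[OF t] True by auto
    have "t (k + 1) * (2 * t (k + 3)) \<le> (t (k + 2))\<^sup>2"
      using log_concave_upto_ineq[OF log_concave_upto_weaken[OF t \<alpha>], of "k + 1"] True
      by (simp add: mult_ac numeral_3_eq_3)
    also have "\<dots> \<le> t (k + 1) * (t (k + 2) / 2)"
      using mult_right_mono[OF h, of "t (k + 2)"] pos by (simp add: power2_eq_square)
    finally have "2 * t (k + 3) \<le> t (k + 2) / 2" using pos by (simp only: mult_le_cancel_left_pos)
    moreover have "t (k + 3) \<le> t (k + 2)" using calculation pos by simp
    then have "right_tail n t (k + 2) \<le> t (k + 3)"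
      using right_tail_bounds(2)[OF t1, of "k + 2" "k + 2"] True by (simp add: numeral_3_eq_3)
    ultimately show ?thesis by simp
  qed
  then show ?thesis
    using right_tail_step[of k n t] right_tail_step[of "k + 1" n t] k by simp
qed

lemma alternating_sum_ge_five_terms:
  assumes t: "log_concave_upto \<alpha> n t" and \<alpha>: "\<alpha> \<ge> 2" and k: "2 \<le> k" "k + 2 \<le> n"
    and le: "t (k - 1) \<le> t k" "t (k + 1) \<le> t k"
  shows "t k - t (k - 1) - t (k + 1) + 3 / 4 * (t (k - 2) + t (k + 2))
       \<le> (\<Sum>j\<le>n. (-1) ^ (j + k) * t j)"
proof -
  have right: "right_tail n t k \<le> t (k + 1) - 3 / 4 * t (k + 2)"
    using right_tail_le_two_terms[OF t \<alpha>] k le by simp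
  have "n - (n - k + 1) = k - 1" "n - (n - k) = k" "n - (n - k + 2) = k - 2" using k by auto
  then have left: "right_tail n (\<lambda>j. t (n - j)) (n - k) \<le> t (k - 1) - 3 / 4 * t (k - 2)"
    using right_tail_le_two_terms[OF log_concave_upto_reverse[OF t] \<alpha>, of "n - k"] k le by simp
  from add_mono[OF right left] show ?thesis
    using alternating_sum_split[of k n t] k by (simp add: distrib_left)
qed

section \<open>Alternating signs at points separated by the coefficient quotients\<close>

text \<open>
  The two strict inequalities say that the term with index \<open>k\<close> is larger than both of its
  neighbours at \<open>y\<close>. They place \<open>y\<close> in an interval that lies to the left of the corresponding
  interval for \<open>k + 1\<close>. Since subtraction on natural numbers is truncated, the notion is meaningful
  for \<open>k > 0\<close> only.
\<close>

definition sign_point :: "nat \<Rightarrow> (nat \<Rightarrow> real) \<Rightarrow> nat \<Rightarrow> real \<Rightarrow> bool" where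
  "sign_point n c k y \<longleftrightarrow> 0 < y \<and> c (k - 1) < c k * y \<and> c (k + 1) * y < c k
     \<and> 0 \<le> (\<Sum>j\<le>n. (-1) ^ (j + k) * (c j * y ^ j))"

text \<open>
  Substituting \<open>1 / y\<close> and multiplying by \<open>y\<^sup>n\<close> reverses the coefficients of a polynomial.
\<close>

lemma sign_point_reverse:
  assumes s: "sign_point n (\<lambda>j. c (n - j)) (n - k) y" and k: "0 < k" "k < n"
  shows "sign_point n c k (1 / y)"
proof -
  have y: "y > 0" using s by (simp add: sign_point_def)
  have idx: "n - (n - k - 1) = k + 1" "n - (n - k) = k" "n - (n - k + 1) = k - 1" using k by auto
  have "(\<Sum>j\<le>n. (-1) ^ (j + (n - k)) * (c (n - j) * y ^ j))
      = (\<Sum>j\<le>n. (-1) ^ ((n - j) + (n - k)) * (c j * y ^ (n - j)))"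
    by (rule sum.reindex_bij_witness[of _ "\<lambda>j. n - j" "\<lambda>j. n - j"]) auto
  also have "\<dots> = (\<Sum>j\<le>n. y ^ n * ((-1) ^ (j + k) * (c j * (1 / y) ^ j)))"
  proof (rule sum.cong)
    fix j assume "j \<in> {..n}"
    then have j: "j \<le> n" by simp
    have "even ((n - j) + (n - k)) \<longleftrightarrow> even (j + k)" using j k by auto
    then have "(-1::real) ^ ((n - j) + (n - k)) = (-1) ^ (j + k)"
      by (simp add: minus_one_power_iff)
    moreover have "y ^ (n - j) = y ^ n * (1 / y) ^ j"
      using y j by (simp add: power_diff power_divide)
    ultimately show "(-1) ^ ((n - j) + (n - k)) * (c j * y ^ (n - j))
        = y ^ n * ((-1) ^ (j + k) * (c j * (1 / y) ^ j))" by (simp add: mult_ac)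
  qed simp
  also have "\<dots> = y ^ n * (\<Sum>j\<le>n. (-1) ^ (j + k) * (c j * (1 / y) ^ j))"
    by (simp add: sum_distrib_left)
  finally have "0 \<le> y ^ n * (\<Sum>j\<le>n. (-1) ^ (j + k) * (c j * (1 / y) ^ j))"
    using s by (simp add: sign_point_def)
  then have "0 \<le> (\<Sum>j\<le>n. (-1) ^ (j + k) * (c j * (1 / y) ^ j))"
    using zero_less_power[OF y, of n] by (simp only: zero_le_mult_iff) linarith
  then show ?thesis
    using s y idx by (simp add: sign_point_def field_simps)
qed

lemma poly_at_minus:
  fixes c :: "nat \<Rightarrow> real"
  shows "(-1) ^ k * poly (\<Sum>j\<le>n. monom (c j) j) (- y) = (\<Sum>j\<le>n. (-1) ^ (j + k) * (c j * y ^ j))"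
proof -
  have "(- y) ^ j = (-1) ^ j * y ^ j" for j by (rule power_minus)
  then show ?thesis
    by (simp add: poly_sum poly_monom sum_distrib_left power_add mult_ac)
qed

text \<open>
  Points for the two missing indices are always available: \<open>0\<close> for \<open>k = 0\<close>, and for \<open>k = n\<close> any number
  above \<open>c\<^sub>n\<^sub>-\<^sub>1 / c\<^sub>n\<close>, because there the last term is the largest one.
\<close>

lemma sign_points_imp_real_zeros:
  assumes c: "log_concave_upto 1 n c" and n: "n \<ge> 1"
    and pts: "\<And>k. 0 < k \<Longrightarrow> k < n \<Longrightarrow> \<exists>y. sign_point n c k y"
    and zero: "poly (map_poly of_real (\<Sum>j\<le>n. monom (c j) j)) (z::complex) = 0"
  shows "z \<in> \<real>"
proof -
  let ?Q = "\<Sum>j\<le>n. monom (c j) j"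
  from pts obtain f where f: "\<And>k. 0 < k \<Longrightarrow> k < n \<Longrightarrow> sign_point n c k (f k)" by metis
  \<comment> \<open>adding 1 keeps the last point strictly to the right of the previous one\<close>
  define y where "y k = (if k = 0 then 0 else if k < n then f k else c (n - 1) / c n + 1)" for k
  have pos: "c j > 0" if "j \<le> n" for j using log_concave_upto_pos[OF c that] .
  have lower: "c (k - 1) < c k * y k \<and> 0 < y k" if "0 < k" "k \<le> n" for k
  proof (cases "k < n")
    case True
    then show ?thesis using f[of k] that by (simp add: y_def sign_point_def)
  next
    case False
    then have "k = n" using that by simp
    then show ?thesis using pos[of n] pos[of "n - 1"] n by (simp add: y_def field_simps add_pos_pos)
  qed
  have upper: "c (k + 1) * y k < c k" if "k < n" for k
    using f[of k] that pos[of k] by (auto simp: y_def sign_point_def)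
  have inc: "y k < y (Suc k)" if "k < n" for k
  proof -
    have "c (Suc k) * y k < c (Suc k) * y (Suc k)"
      using upper[of k] lower[of "Suc k"] that by simp
    then show ?thesis using pos[of "Suc k"] that by simp
  qed
  have alt: "0 \<le> (-1) ^ k * poly ?Q (- y k)" if "k \<le> n" for k
  proof -
    consider "k = 0" | "0 < k" "k < n" | "k = n" using \<open>k \<le> n\<close> by linarith
    then show ?thesis
    proof cases
      case 1
      have "(\<Sum>j\<le>n. c j * 0 ^ j) = (\<Sum>j\<le>n. if j = 0 then c 0 else 0)"
        by (rule sum.cong) auto
      then show ?thesis using 1 pos[of 0] by (simp add: y_def poly_sum poly_monom)
    next
      case 2
      then show ?thesis using f[of k] by (simp add: poly_at_minus y_def sign_point_def)
    next
      case 3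
      have "c (n - 1) * y n ^ (n - 1) < c n * y n ^ n"
        using lower[of n] n by (cases n) (auto simp: mult.assoc[symmetric])
      then show ?thesis
        using alternating_sum_top_pos[OF log_concave_upto_scale[OF c] n, of "y n"] lower[of n] n 3
        by (simp add: poly_at_minus less_imp_le)
    qed
  qed
  show ?thesis
  proof (rule weak_alternation_imp_real_zeros[where p = ?Q and n = n and x = "\<lambda>k. - y k"])
    show "degree ?Q \<le> n" by (intro degree_sum_le) (auto intro: order_trans[OF degree_monom_le])
    show "coeff ?Q n > 0" using pos[of n] by (simp add: coeff_sum)
  qed (use inc alt zero in auto)
qed

lemma sign_points_imp_zeros_in_unit_segment:
  assumes c: "log_concave_upto 1 n c" and n: "n \<ge> 1"
    and pts: "\<And>k. 0 < k \<Longrightarrow> k < n \<Longrightarrow> \<exists>y. sign_point n c k y"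
    and top: "c (n - 1) \<le> c n"
  shows "only_real_zeros_in (\<Sum>j\<le>n. monom (c j) j) {-1..0}"
  unfolding only_real_zeros_in_def
proof (intro allI impI)
  let ?Q = "\<Sum>j\<le>n. monom (c j) j"
  fix z :: complex
  assume zero: "poly (map_poly of_real ?Q) z = 0"
  have real: "z \<in> \<real>" by (rule sign_points_imp_real_zeros[OF c n pts zero])
  then obtain r where r: "z = of_real r" by (elim Reals_cases)
  have root: "poly ?Q r = 0" using zero by (simp only: r poly_map_poly_complex_of_real of_real_eq_0_iff)
  have pos: "c j > 0" if "j \<le> n" for j using log_concave_upto_pos[OF c that] .
  have "r \<le> 0"
  proof (rule ccontr)
    assume "\<not> r \<le> 0"
    then have "0 < (\<Sum>j\<le>n. c j * r ^ j)" using pos by (intro sum_pos) auto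
    then show False using root by (simp add: poly_sum poly_monom)
  qed
  moreover have "- 1 \<le> r"
  proof (rule ccontr)
    assume "\<not> - 1 \<le> r"
    then have y: "- r > 1" by simp
    have "c (n - 1) < c n * (- r)"
      using mult_strict_left_mono[OF y, of "c n"] pos[of n] top by simp
    then have "c (n - 1) * (- r) ^ (n - 1) < c n * (- r) * (- r) ^ (n - 1)"
      using y by (intro mult_strict_right_mono zero_less_power) auto
    also have "\<dots> = c n * (- r) ^ n" using n by (cases n) auto
    finally have "0 < (\<Sum>j\<le>n. (-1) ^ (j + n) * (c j * (- r) ^ j))"
      using alternating_sum_top_pos[OF log_concave_upto_scale[OF c] n, of "- r"] y by simp
    then show False using root poly_at_minus[where k = n and n = n and c = c and y = "- r"] by simp
  qed
  ultimately show "z \<in> \<real> \<and> Re z \<in> {- 1..0}" using real r by simp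
qed

section \<open>Points with the required sign\<close>

text \<open>
  The point is the geometric mean of \<open>c\<^sub>k\<^sub>-\<^sub>1 / c\<^sub>k\<close> and \<open>c\<^sub>k / c\<^sub>k\<^sub>+\<^sub>1\<close>, the ends of the interval on which
  the term with index \<open>k\<close> is the peak.
\<close>

lemma midpoint_exists:
  fixes c :: "nat \<Rightarrow> real"
  assumes pos: "c (k - 1) > 0" "c k > 0" "c (k + 1) > 0"
    and strict: "c (k - 1) * c (k + 1) < (c k)\<^sup>2" and k: "0 < k"
  shows "\<exists>y>0. c (k - 1) < c k * y \<and> c (k + 1) * y < c k
           \<and> c (k - 1) * y ^ (k - 1) = c (k + 1) * y ^ (k + 1)"
proof -
  define y where "y = sqrt (c (k - 1) / c (k + 1))"
  have y: "y > 0" using pos by (simp add: y_def)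
  have "y\<^sup>2 = c (k - 1) / c (k + 1)" using pos by (simp add: y_def)
  then have sq: "c (k + 1) * y\<^sup>2 = c (k - 1)" using pos by simp
  have "(c (k + 1) * y)\<^sup>2 = c (k + 1) * (c (k + 1) * y\<^sup>2)" by (simp add: power2_eq_square)
  also have "\<dots> = c (k + 1) * c (k - 1)" by (simp only: sq)
  also have "\<dots> < (c k)\<^sup>2" using strict by (simp only: mult.commute)
  finally have up: "c (k + 1) * y < c k" by (rule power2_less_imp_less) (use pos in simp)
  have "c (k - 1) = (c (k + 1) * y) * y" using sq by (simp add: power2_eq_square mult.assoc)
  also have "\<dots> < c k * y" using up y by simp
  finally have lo: "c (k - 1) < c k * y" .
  have "y ^ (k + 1) = y\<^sup>2 * y ^ (k - 1)" using k by (cases k) (simp_all add: power2_eq_square)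
  then have "c (k + 1) * y ^ (k + 1) = (c (k + 1) * y\<^sup>2) * y ^ (k - 1)" by (simp add: mult.assoc)
  then have "c (k - 1) * y ^ (k - 1) = c (k + 1) * y ^ (k + 1)" unfolding sq by simp
  then show ?thesis using y lo up by blast
qed

lemma neighbours_le_peak:
  fixes c :: "nat \<Rightarrow> real"
  assumes "0 < y" "0 < k" "c (k - 1) \<le> c k * y" "c (k + 1) * y \<le> c k"
  shows "c (k - 1) * y ^ (k - 1) \<le> c k * y ^ k" and "c (k + 1) * y ^ (k + 1) \<le> c k * y ^ k"
proof -
  have "c (k - 1) * y ^ (k - 1) \<le> (c k * y) * y ^ (k - 1)"
    using assms by (intro mult_right_mono) auto
  also have "\<dots> = c k * y ^ k" using assms(2) by (cases k) auto
  finally show "c (k - 1) * y ^ (k - 1) \<le> c k * y ^ k" .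
  have "(c (k + 1) * y) * y ^ k \<le> c k * y ^ k"
    using assms by (intro mult_right_mono) auto
  then show "c (k + 1) * y ^ (k + 1) \<le> c k * y ^ k" by (simp add: mult.assoc)
qed

lemma sign_point_of_ratio_ge_4:
  assumes c: "log_concave_upto \<alpha> n c" "\<alpha> > 1" and k: "0 < k" "k < n"
    and four: "4 * (c (k - 1) * c (k + 1)) \<le> (c k)\<^sup>2"
  shows "\<exists>y. sign_point n c k y"
proof -
  have pos: "c (k - 1) > 0" "c k > 0" "c (k + 1) > 0" using log_concave_upto_pos[OF c(1)] k by auto
  obtain y where y: "y > 0" "c (k - 1) < c k * y" "c (k + 1) * y < c k"
      and eq: "c (k - 1) * y ^ (k - 1) = c (k + 1) * y ^ (k + 1)"
    using midpoint_exists[OF pos log_concave_upto_strict[OF c k] k(1)] by blast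
  define t where "t j = c j * y ^ j" for j
  have t: "log_concave_upto 1 n t"
    unfolding t_def using log_concave_upto_scale[OF _ y(1)] log_concave_upto_weaken[OF c(1)] c(2) by simp
  have tpos: "t (k - 1) > 0" "t k > 0" using log_concave_upto_pos[OF t] k by auto
  have "4 * (t (k - 1) * t (k + 1)) = 4 * (c (k - 1) * c (k + 1)) * (y ^ k)\<^sup>2"
    unfolding t_def power_weight_product_centred[OF k(1)] by simp
  also have "\<dots> \<le> (c k)\<^sup>2 * (y ^ k)\<^sup>2" using four by (rule mult_right_mono) simp
  also have "\<dots> = (t k)\<^sup>2" by (simp add: t_def power_mult_distrib)
  finally have "(2 * t (k - 1))\<^sup>2 \<le> (t k)\<^sup>2"
    using eq by (simp add: t_def power2_eq_square)
  then have "2 * t (k - 1) \<le> t k" by (rule power2_le_imp_le) (use tpos in simp)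
  moreover have "t k - t (k - 1) - t (k + 1) \<le> (\<Sum>j\<le>n. (-1) ^ (j + k) * t j)"
    using alternating_sum_ge_neighbours[OF t k] neighbours_le_peak[of y k c] y k by (simp add: t_def)
  moreover have "t (k + 1) = t (k - 1)" using eq by (simp add: t_def)
  ultimately have "0 \<le> (\<Sum>j\<le>n. (-1) ^ (j + k) * t j)" by linarith
  then show ?thesis using y by (auto simp: sign_point_def t_def)
qed

text \<open>
  For \<open>2 < \<alpha> < 4\<close> the interval from \<open>\<alpha>\<close> to \<open>8 / (\<alpha> (4 - \<alpha>))\<close> is nonempty if and only if \<open>1 + sqrt 5 \<le> \<alpha>\<close>.
  The estimates below rely on the rational consequence \<open>16/5 \<le> \<alpha>\<close>.
\<close>

lemma sqrt5_bound: "1 + sqrt 5 > 16 / (5::real)"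
proof -
  have "11 / 5 < sqrt (5::real)" by (rule real_less_rsqrt) (simp add: power2_eq_square)
  then show ?thesis by simp
qed

text \<open>
  Here \<open>s\<close> is the ratio of the peak to its two equal neighbours. The deficit \<open>s (2 - s)\<close> is at most
  \<open>(4 - \<alpha>) / 2\<close>, while the two outer terms contribute \<open>3 \<alpha> (4 - \<alpha>) / 16\<close>, which is more because
  \<open>\<alpha> > 8 / 3\<close>.
\<close>

lemma middle_quadratic_nonneg:
  fixes \<alpha> \<beta> s :: real
  assumes \<alpha>: "16 / 5 \<le> \<alpha>" "\<alpha> < 4" and \<beta>: "\<beta> = 8 / (\<alpha> * (4 - \<alpha>))"
    and s: "0 < s" "\<alpha> \<le> s\<^sup>2" "s\<^sup>2 < 4"
  shows "s\<^sup>2 - 2 * s + 3 / 2 / \<beta> \<ge> 0"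
proof -
  have s2: "s < 2" by (rule power2_less_imp_less) (use s in simp_all)
  have "2 * (s * (2 - s)) \<le> (2 + s) * (2 - s)"
    using mult_right_mono[of "2 * s" "2 + s" "2 - s"] s2 by simp
  also have "\<dots> = 4 - s\<^sup>2" by (simp add: algebra_simps power2_eq_square)
  also have "\<dots> \<le> 4 - \<alpha>" using s by simp
  finally have "s * (2 - s) \<le> (4 - \<alpha>) / 2" by simp
  also have "\<dots> \<le> 3 / 16 * (\<alpha> * (4 - \<alpha>))"
    using mult_right_mono[OF \<alpha>(1), of "4 - \<alpha>"] \<alpha> by simp
  also have "\<dots> = 3 / 2 / \<beta>" by (simp add: \<beta>)
  finally show ?thesis by (simp add: algebra_simps power2_eq_square)
qed

text \<open>
  With the two neighbours of the peak both equal to \<open>p\<close>, the upper bound \<open>\<beta>\<close> for the quotients bounds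
  each of the terms with indices \<open>k - 2\<close> and \<open>k + 2\<close> from below by \<open>p / (\<beta> s)\<close>, and three quarters of
  them survive in the alternating sum.
\<close>

lemma sign_point_middle:
  assumes c: "log_concave_upto \<alpha> n c" and \<alpha>: "16 / 5 \<le> \<alpha>" "\<alpha> < 4"
    and \<beta>: "\<beta> = 8 / (\<alpha> * (4 - \<alpha>))"
    and upper: "\<And>j. j + 2 \<le> n \<Longrightarrow> (c (j + 1))\<^sup>2 \<le> \<beta> * (c j * c (j + 2))"
    and k: "2 \<le> k" "k + 2 \<le> n"
  shows "\<exists>y. sign_point n c k y"
proof (cases "4 * (c (k - 1) * c (k + 1)) \<le> (c k)\<^sup>2")
  case True
  then show ?thesis using sign_point_of_ratio_ge_4[OF c] \<alpha> k by simp
next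
  case False
  have k': "0 < k" "k < n" using k by auto
  have \<beta>pos: "\<beta> > 0" using \<alpha> by (simp add: \<beta>)
  have pos: "c (k - 1) > 0" "c k > 0" "c (k + 1) > 0" using log_concave_upto_pos[OF c] k by auto
  have \<alpha>1: "\<alpha> > 1" using \<alpha> by simp
  obtain y where y: "y > 0" "c (k - 1) < c k * y" "c (k + 1) * y < c k"
      and eq: "c (k - 1) * y ^ (k - 1) = c (k + 1) * y ^ (k + 1)"
    using midpoint_exists[OF pos log_concave_upto_strict[OF c \<alpha>1 k'] k'(1)] by blast
  define t where "t j = c j * y ^ j" for j
  have t: "log_concave_upto \<alpha> n t"
    unfolding t_def by (rule log_concave_upto_scale[OF c y(1)])
  define p where "p = t (k - 1)"
  have p: "p > 0" "t (k + 1) = p" and tk: "t k > 0"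
    using log_concave_upto_pos[OF t, of "k - 1"] log_concave_upto_pos[OF t, of k] k eq
    by (simp_all add: p_def t_def)
  define s where "s = t k / p"
  have s: "s > 0" "t k = s * p" using p tk by (auto simp: s_def)
  have "\<alpha> * p\<^sup>2 \<le> s\<^sup>2 * p\<^sup>2"
    using log_concave_upto_ineq_centred[OF t k', folded p_def] unfolding p(2) s(2)
    by (simp add: power2_eq_square mult_ac)
  then have s\<alpha>: "\<alpha> \<le> s\<^sup>2" using p by simp
  have "s\<^sup>2 * p\<^sup>2 < 4 * p\<^sup>2"
  proof -
    have "(t k)\<^sup>2 = (c k)\<^sup>2 * (y ^ k)\<^sup>2" by (simp add: t_def power_mult_distrib)
    also have "\<dots> < 4 * (c (k - 1) * c (k + 1)) * (y ^ k)\<^sup>2"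
      using False y by (intro mult_strict_right_mono) auto
    also have "\<dots> = 4 * (t (k - 1) * t (k + 1))"
      unfolding t_def power_weight_product_centred[OF k'(1)] by simp
    finally show ?thesis
      unfolding p_def[symmetric] p(2) s(2) by (simp add: power2_eq_square mult_ac)
  qed
  then have s4: "s\<^sup>2 < 4" using p by simp
  have upper_t: "(t (j + 1))\<^sup>2 \<le> \<beta> * (t j * t (j + 2))" if "j + 2 \<le> n" for j
  proof -
    have "(c (j + 1))\<^sup>2 * (y ^ (j + 1))\<^sup>2 \<le> \<beta> * (c j * c (j + 2)) * (y ^ (j + 1))\<^sup>2"
      using upper[OF that] by (rule mult_right_mono) simp
    then show ?thesis unfolding t_def power_weight_products by (simp only: mult.assoc)
  qed
  have idx: "k - 2 + 1 = k - 1" "k - 2 + 2 = k" using k by auto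
  have "p\<^sup>2 \<le> \<beta> * (t (k - 2) * t k)"
    using upper_t[of "k - 2"] k unfolding idx p_def by simp
  moreover have "p\<^sup>2 \<le> \<beta> * (t k * t (k + 2))"
    using upper_t[of k] k unfolding p(2) by simp
  ultimately have "p * p \<le> p * (\<beta> * s * t (k - 2))" "p * p \<le> p * (\<beta> * s * t (k + 2))"
    by (simp_all add: s power2_eq_square mult_ac)
  then have "p \<le> \<beta> * s * t (k - 2)" "p \<le> \<beta> * s * t (k + 2)"
    using p(1) by (simp_all only: mult_le_cancel_left_pos)
  then have outer: "p / (\<beta> * s) \<le> t (k - 2)" "p / (\<beta> * s) \<le> t (k + 2)"
    using \<beta>pos s by (simp_all add: pos_divide_le_eq mult_ac)
  have "0 \<le> (s\<^sup>2 - 2 * s + 3 / 2 / \<beta>) * (p / s)"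
    using middle_quadratic_nonneg[OF \<alpha> \<beta> s(1) s\<alpha> s4] p s by simp
  also have "\<dots> = s * p - p - p + 3 / 4 * (p / (\<beta> * s) + p / (\<beta> * s))"
    using s \<beta>pos by (simp add: field_simps power2_eq_square)
  also have "\<dots> \<le> t k - t (k - 1) - t (k + 1) + 3 / 4 * (t (k - 2) + t (k + 2))"
    unfolding p_def[symmetric] p(2) s(2)
    by (intro add_left_mono mult_left_mono add_mono outer) simp
  also have "\<dots> \<le> (\<Sum>j\<le>n. (-1) ^ (j + k) * t j)"
    using alternating_sum_ge_five_terms[OF t _ k] neighbours_le_peak[of y k c] y k \<alpha>
    by (simp add: t_def)
  finally show ?thesis using y by (auto simp: sign_point_def t_def)
qed

text \<open>
  Up to a positive factor the expression is \<open>Z - 1 - (Z\<^sup>2 - 2/b) / \<alpha>\<close> with \<open>Z = 1/Y + Y/b\<close>. Its maximum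
  is attained for \<open>Z = \<alpha>/2\<close> and equals \<open>\<alpha>/4 - 1 + 2/(\<alpha> b)\<close>, which is nonnegative if and only if
  \<open>b \<le> 8 / (\<alpha> (4 - \<alpha>))\<close>. The equation \<open>Z = \<alpha>/2\<close> means \<open>Y\<^sup>2 - (\<alpha> b / 2) Y + b = 0\<close>, and the intermediate
  value theorem provides a solution between \<open>1/\<alpha>\<close> and \<open>1\<close>, the range in which the linear term is
  the peak.
\<close>

lemma quartic_point_exists:
  fixes \<alpha> b :: real
  assumes \<alpha>: "16 / 5 \<le> \<alpha>" "\<alpha> < 4" and b: "\<alpha> \<le> b" "b \<le> 8 / (\<alpha> * (4 - \<alpha>))"
  shows "\<exists>Y. 1 / \<alpha> < Y \<and> Y < 1 \<and> 0 \<le> 1 - 1 / (\<alpha> * Y) - Y + Y\<^sup>2 / b - Y ^ 3 / (b\<^sup>2 * \<alpha>)"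
proof -
  let ?q = "[:b, - (\<alpha> * b / 2), 1:]"
  have b0: "b > 0" and a0: "\<alpha> > 0" using \<alpha> b by auto
  have "poly ?q (1 / \<alpha>) = b / 2 + (1 / \<alpha>)\<^sup>2" using a0 by (simp add: field_simps power2_eq_square)
  then have q1: "poly ?q (1 / \<alpha>) > 0" using b0 a0 by (simp add: add_pos_pos)
  have "16 / 5 * b \<le> \<alpha> * b" using \<alpha> b0 by (intro mult_right_mono) auto
  then have "b + (1 - \<alpha> * b / 2) < 0" using b \<alpha> by linarith
  then have q2: "poly ?q 1 < 0" by simp
  obtain Y where Y: "1 / \<alpha> < Y" "Y < 1" "poly ?q Y = 0"
    using poly_IVT_neg[of "1 / \<alpha>" 1 ?q] q1 q2 \<alpha> by auto
  have Y0: "Y > 0" using Y(1) a0 by (meson divide_pos_pos less_trans zero_less_one)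
  define Z where "Z = 1 / Y + Y / b"
  have "Y\<^sup>2 + b = \<alpha> * b / 2 * Y" using Y(3) by (simp add: algebra_simps power2_eq_square)
  moreover have "Z = (Y\<^sup>2 + b) / (b * Y)"
    using Y0 b0 by (simp add: Z_def field_simps power2_eq_square)
  ultimately have Z: "Z = \<alpha> / 2" using Y0 b0 by simp
  have factor: "1 - 1 / (\<alpha> * Y) - Y + Y\<^sup>2 / b - Y ^ 3 / (b\<^sup>2 * \<alpha>) = Y * (Z - 1 - (Z\<^sup>2 - 2 / b) / \<alpha>)"
    using Y0 b0 a0 by (simp add: Z_def field_simps power2_eq_square power3_eq_cube)
  have "Z - 1 - (Z\<^sup>2 - 2 / b) / \<alpha> = \<alpha> / 4 - 1 + 2 / (\<alpha> * b)"
    using a0 b0 by (simp add: Z field_simps power2_eq_square)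
  also have "\<dots> \<ge> 0"
  proof -
    have "b * (\<alpha> * (4 - \<alpha>)) \<le> 8" using b(2) \<alpha> by (simp add: pos_le_divide_eq)
    then show ?thesis using a0 b0 by (simp add: field_simps)
  qed
  finally have "0 \<le> 1 - 1 / (\<alpha> * Y) - Y + Y\<^sup>2 / b - Y ^ 3 / (b\<^sup>2 * \<alpha>)"
    unfolding factor using Y0 by simp
  then show ?thesis using Y by blast
qed

text \<open>
  The terms are measured in units of the peak \<open>T = t\<^sub>1\<close>. Writing \<open>t\<^sub>2 = Y T\<close> and \<open>b = q\<^sub>3\<close>, one has
  \<open>t\<^sub>3 = (Y\<^sup>2 / b) T\<close>, whereas \<open>t\<^sub>0\<close> and \<open>t\<^sub>4\<close> depend on \<open>q\<^sub>2\<close> and \<open>q\<^sub>4\<close> and are largest when these quotients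
  take their smallest value \<open>\<alpha>\<close>. Both terms are harmful, so this reduces the claim to the symmetric
  quartic.
\<close>

lemma sign_point_first:
  assumes c: "log_concave_upto \<alpha> n c" and \<alpha>: "16 / 5 \<le> \<alpha>" "\<alpha> < 4"
    and upper: "(c 2)\<^sup>2 \<le> 8 / (\<alpha> * (4 - \<alpha>)) * (c 1 * c 3)" and n: "4 \<le> n"
  shows "\<exists>y. sign_point n c 1 y"
proof -
  have pos: "c 0 > 0" "c 1 > 0" "c 2 > 0" "c 3 > 0" "c 4 > 0"
    using log_concave_upto_pos[OF c] n by auto
  have ineq: "\<alpha> * (c 0 * c 2) \<le> (c 1)\<^sup>2" "\<alpha> * (c 1 * c 3) \<le> (c 2)\<^sup>2" "\<alpha> * (c 2 * c 4) \<le> (c 3)\<^sup>2"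
    using log_concave_upto_ineq[OF c, of 0] log_concave_upto_ineq[OF c, of 1]
      log_concave_upto_ineq[OF c, of 2] n by (simp_all add: numeral_3_eq_3 numeral_2_eq_2 eval_nat_numeral)
  define b where "b = (c 2)\<^sup>2 / (c 1 * c 3)"
  have b: "\<alpha> \<le> b" "b \<le> 8 / (\<alpha> * (4 - \<alpha>))"
    using ineq(2) upper pos by (simp_all add: b_def pos_le_divide_eq pos_divide_le_eq)
  obtain Y where Y: "1 / \<alpha> < Y" "Y < 1"
      and nonneg: "0 \<le> 1 - 1 / (\<alpha> * Y) - Y + Y\<^sup>2 / b - Y ^ 3 / (b\<^sup>2 * \<alpha>)"
    using quartic_point_exists[OF \<alpha> b] by blast
  have a0: "\<alpha> > 0" and b0: "b > 0" using \<alpha> b by auto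
  have Y0: "Y > 0" using Y(1) a0 by (meson divide_pos_pos less_trans zero_less_one)
  \<comment> \<open>the choice for which the quotient of the terms with indices 2 and 1 is \<open>Y\<close>\<close>
  define y where "y = Y * c 1 / c 2"
  have y: "y > 0" using Y0 pos by (simp add: y_def)
  define t where "t j = c j * y ^ j" for j
  have t: "log_concave_upto \<alpha> n t" unfolding t_def by (rule log_concave_upto_scale[OF c y])
  have t1: "log_concave_upto 1 n t" using log_concave_upto_weaken[OF t] \<alpha> by simp
  define T where "T = t 1"
  have T: "T > 0" using pos y by (simp add: T_def t_def)
  have tpos: "t 0 > 0" "t 2 > 0" "t 3 > 0" using pos y by (auto simp: t_def)
  have e2: "t 2 = Y * T" using pos by (simp add: T_def t_def y_def power2_eq_square)
  have e3: "t 3 = Y\<^sup>2 / b * T"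
    using pos by (simp add: T_def t_def y_def b_def field_simps power2_eq_square power3_eq_cube)
  have b_0: "t 0 \<le> 1 / (\<alpha> * Y) * T"
  proof -
    have "T * (\<alpha> * Y * t 0) \<le> T * T"
      using log_concave_upto_ineq[OF t, of 0] n e2 by (simp add: T_def power2_eq_square numeral_2_eq_2 mult_ac)
    then have "\<alpha> * Y * t 0 \<le> T" using T by (simp only: mult_le_cancel_left_pos)
    then show ?thesis using a0 Y0 by (simp add: field_simps)
  qed
  have b_4: "t 4 \<le> Y ^ 3 / (b\<^sup>2 * \<alpha>) * T"
  proof -
    have "\<alpha> * (t 2 * t 4) \<le> (t 3)\<^sup>2"
      using log_concave_upto_ineq[OF t, of 2] n by (simp add: eval_nat_numeral)
    then have "(T * Y) * (\<alpha> * t 4) \<le> (T * Y) * (Y ^ 3 / b\<^sup>2 * T)"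
      unfolding e2 e3 by (simp add: power2_eq_square power3_eq_cube mult_ac)
    then have "\<alpha> * t 4 \<le> Y ^ 3 / b\<^sup>2 * T" using T Y0 by (simp only: mult_le_cancel_left_pos mult_pos_pos)
    then show ?thesis using a0 b0 by (simp add: field_simps)
  qed
  have lo: "c 0 < c 1 * y"
  proof -
    have "\<alpha> * Y * t 0 \<le> T" using b_0 a0 Y0 by (simp add: field_simps)
    moreover have "1 * t 0 < \<alpha> * Y * t 0"
      using Y(1) a0 tpos by (intro mult_strict_right_mono) (auto simp: field_simps)
    ultimately show ?thesis by (simp add: T_def t_def)
  qed
  have up: "c 2 * y < c 1" using Y(2) pos by (simp add: y_def)
  have dec: "t 2 \<le> t 1" using e2 Y T by (simp add: T_def mult_le_cancel_right1)
  have "right_tail n t 1 = t 2 - t 3 + t 4 - right_tail n t 4"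
    using right_tail_step[of 1 n t] right_tail_step[of 2 n t] right_tail_step[of 3 n t] n
    by (simp add: eval_nat_numeral)
  moreover have "right_tail n t 4 \<ge> 0"
    using right_tail_bounds(1)[OF t1, of 1 4] dec n by (simp add: eval_nat_numeral)
  moreover have "right_tail n (\<lambda>j. t (n - j)) (n - 1) = t 0" using n by (simp add: right_tail_def)
  ultimately have "t 1 - t 0 - t 2 + t 3 - t 4 \<le> (\<Sum>j\<le>n. (-1) ^ (j + 1) * t j)"
    using alternating_sum_split[of 1 n t] n by simp
  moreover have "0 \<le> t 1 - t 0 - t 2 + t 3 - t 4"
  proof -
    have "0 \<le> (1 - 1 / (\<alpha> * Y) - Y + Y\<^sup>2 / b - Y ^ 3 / (b\<^sup>2 * \<alpha>)) * T"
      using nonneg T by simp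
    also have "\<dots> = T - 1 / (\<alpha> * Y) * T - t 2 + t 3 - Y ^ 3 / (b\<^sup>2 * \<alpha>) * T"
      unfolding e2 e3 by (simp only: left_diff_distrib distrib_right mult_1_left)
    also have "\<dots> \<le> t 1 - t 0 - t 2 + t 3 - t 4" using b_0 b_4 by (simp add: T_def)
    finally show ?thesis .
  qed
  ultimately have "0 \<le> (\<Sum>j\<le>n. (-1) ^ (j + 1) * t j)" by linarith
  then show ?thesis using y lo up by (auto simp: sign_point_def t_def numeral_2_eq_2)
qed

lemma sign_points_of_ratio_interval:
  assumes c: "log_concave_upto \<alpha> n c" and \<alpha>: "16 / 5 \<le> \<alpha>" "\<alpha> < 4"
    and \<beta>: "\<beta> = 8 / (\<alpha> * (4 - \<alpha>))"
    and upper: "\<And>j. j + 2 \<le> n \<Longrightarrow> (c (j + 1))\<^sup>2 \<le> \<beta> * (c j * c (j + 2))"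
    and n: "4 \<le> n" and k: "0 < k" "k < n"
  shows "\<exists>y. sign_point n c k y"
proof -
  consider "k = 1" | "2 \<le> k" "k + 2 \<le> n" | "k = n - 1" using k by linarith
  then show ?thesis
  proof cases
    case 1
    then show ?thesis
      using sign_point_first[OF c \<alpha> _ n] upper[of 1] n
      by (simp add: \<beta> numeral_2_eq_2 numeral_3_eq_3)
  next
    case 2
    then show ?thesis using sign_point_middle[OF c \<alpha> \<beta> upper] by blast
  next
    case 3
    have idx: "n - 3 + 1 = n - 2" "n - 3 + 2 = n - 1" using n by auto
    have "(c (n - 2))\<^sup>2 \<le> \<beta> * (c (n - 1) * c (n - 3))"
      using upper[of "n - 3"] n unfolding idx by (simp add: mult.commute)
    then have "\<exists>y. sign_point n (\<lambda>j. c (n - j)) 1 y"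
      using sign_point_first[OF log_concave_upto_reverse[OF c] \<alpha> _ n] by (simp add: \<beta>)
    then show ?thesis using sign_point_reverse[of n c k] 3 n by auto
  qed
qed

section \<open>The zeros of the transformed polynomial\<close>

theorem theorem5p1:
  fixes a :: real and n :: nat and c :: "nat \<Rightarrow> real" and P :: "real poly"
  assumes "a > 0"
    and "n \<ge> 1"
    and "\<forall>j\<le>n. c j > 0"
    and "P = (\<Sum>k\<le>n. smult (c k) (newton_basis a k))"
  shows "((\<forall>k\<in>{2..n}. (c (k - 1))\<^sup>2 / (c (k - 2) * c k) \<ge> 4) \<and> c (n - 1) / c n \<le> 1
            \<longrightarrow> only_real_zeros_in (L_op a P) {-1..0})
       \<and> (n \<ge> 4
          \<and> (\<exists>\<alpha>. 1 + sqrt 5 \<le> \<alpha> \<and> \<alpha> < 4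
               \<and> (\<forall>k\<in>{2..n}. (c (k - 1))\<^sup>2 / (c (k - 2) * c k) \<in> {\<alpha>..8 / (\<alpha> * (4 - \<alpha>))}))
          \<and> c (n - 1) / c n \<le> 1
            \<longrightarrow> only_real_zeros_in (L_op a P) {-1..0})"
proof -
  have L: "L_op a P = (\<Sum>k\<le>n. monom (c k) k)"
    unfolding assms(4) by (rule L_op_newton_sum[OF assms(1)])
  have top: "c (n - 1) \<le> c n" if "c (n - 1) / c n \<le> 1"
    using that assms(3)[rule_format, of n] by (simp add: pos_divide_le_eq)
  show ?thesis
    unfolding L
  proof (intro conjI impI; elim conjE exE)
    assume ratio: "\<forall>k\<in>{2..n}. 4 \<le> (c (k - 1))\<^sup>2 / (c (k - 2) * c k)" and "c (n - 1) / c n \<le> 1"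
    have c: "log_concave_upto 4 n c" by (rule log_concave_upto_of_ratio_ge[OF assms(3) ratio])
    show "only_real_zeros_in (\<Sum>k\<le>n. monom (c k) k) {-1..0}"
    proof (rule sign_points_imp_zeros_in_unit_segment[OF _ assms(2) _ top])
      show "log_concave_upto 1 n c" using log_concave_upto_weaken[OF c] by simp
      show "\<exists>y. sign_point n c k y" if "0 < k" "k < n" for k
        using sign_point_of_ratio_ge_4[OF c _ that log_concave_upto_ineq_centred[OF c that]] by simp
    qed fact
  next
    fix \<alpha>
    assume n: "4 \<le> n" and "c (n - 1) / c n \<le> 1" and \<alpha>: "1 + sqrt 5 \<le> \<alpha>" "\<alpha> < 4"
      and ratio: "\<forall>k\<in>{2..n}. (c (k - 1))\<^sup>2 / (c (k - 2) * c k) \<in> {\<alpha>..8 / (\<alpha> * (4 - \<alpha>))}"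
    have \<alpha>': "16 / 5 \<le> \<alpha>" using \<alpha>(1) sqrt5_bound by simp
    have c: "log_concave_upto \<alpha> n c"
      by (rule log_concave_upto_of_ratio_ge[OF assms(3)]) (use ratio in auto)
    have upper: "(c (j + 1))\<^sup>2 \<le> 8 / (\<alpha> * (4 - \<alpha>)) * (c j * c (j + 2))" if j: "j + 2 \<le> n" for j
    proof -
      have "(c (j + 1))\<^sup>2 / (c j * c (j + 2)) \<le> 8 / (\<alpha> * (4 - \<alpha>))"
        using ratio[rule_format, of "j + 2"] j by simp
      moreover have "c j * c (j + 2) > 0" using assms(3) j by simp
      ultimately show ?thesis by (simp only: pos_divide_le_eq)
    qed
    show "only_real_zeros_in (\<Sum>k\<le>n. monom (c k) k) {-1..0}"
    proof (rule sign_points_imp_zeros_in_unit_segment[OF _ assms(2) _ top])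
      show "log_concave_upto 1 n c" using log_concave_upto_weaken[OF c] \<alpha>' by simp
      show "\<exists>y. sign_point n c k y" if "0 < k" "k < n" for k
        by (rule sign_points_of_ratio_interval[OF c \<alpha>' \<alpha>(2) refl upper n that])
    qed fact
  qed
qed

end
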